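(* For every integer $n\ge 2$, the number $a^C(C_n)$ of assembly trees satisfying the connected gluing rule for the cycle graph $C_n$ on $n$ vertices is $$a^C(C_n)=\sum_{k=2}^n\left[\sum_{i_1+\cdots+i_k=n}i_1\prod_{j=1}^k SC(i_j)\right],$$ where the inner sum is over all compositions $(i_1,\dots,i_k)$ of $n$ into $k$ positive integer parts and $SC(i)$ is the $i$th super Catalan number.
   Context: All graphs are finite and simple. Let $G=(V,E)$ be a connected graph with $|V|=N$. An assembly tree for $G$ is a rooted (unordered) tree each of whose nodes is labeled by a subset $U\subseteq V$ such that: (1) the label of the root is $V$; (2) each internal node $U$ has at least two children, and $U$ is the union of the labels of its children; (3) there are exactly $N$ leaves, labeled by the $N$ vertices of $G$ respectively (a vertex $v$ being identified with $\{v\}$). Two assembly trees are the same if there is a label-preserving isomorphism of rooted trees between them. An assembly tree satisfies the connected gluing rule if for each internal node, the subgraph of $G$ induced by the vertices in its label is connected. $a^C(G)$ denotes the number of assembly trees for $G$ satisfying the connected gluing rule. $C_n$ is the cycle graph on vertices $1,\dots,n$ (in cyclic order) for $n\ge 3$; by convention $C_1$ is a single vertex and $C_2$ is a single edge on two vertices. The super Catalan numbers (little Schr\"oder numbers, OEIS A001003) $SC(n)$, $n\ge1$, are indexed so that $\sum_{n\ge 1}SC(n)x^n=\frac{1+x-\sqrt{1-6x+x^2}}{4}$ as formal power series, i.e. $SC(1),SC(2),SC(3),\ldots=1,1,3,11,45,\ldots$. *)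

theory Defs
  imports
    Complex_Main
    "HOL-Library.Multiset"
    "HOL-Computational_Algebra.Formal_Power_Series"
    "Graph_Theory.Graph_Theory"
begin

text \<open>
  Finite rooted unordered trees with a label at every node.  Children form a multiset, so two
  values of this type are equal exactly when there is a label-preserving isomorphism of rooted
  trees between them; counting values is counting trees up to such isomorphism.
\<close>

datatype 'l ltree = Node (label: 'l) (children: "'l ltree multiset")

text \<open>
  A node is represented by the full subtree it is the root of.  Nodes with equal subtrees are
  identified, which is harmless for properties required of every node.
\<close>

primrec subtrees :: "'l ltree \<Rightarrow> 'l ltree set" where
  "subtrees (Node l ts) = insert (Node l ts) (\<Union> (set_mset (image_mset subtrees ts)))"

abbreviation internal :: "'l ltree \<Rightarrow> bool" where
  "internal t \<equiv> children t \<noteq> {#}"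

text \<open>The labels of the leaves, with multiplicity.\<close>

primrec leaf_labels :: "'l ltree \<Rightarrow> 'l multiset" where
  "leaf_labels (Node l ts) =
    (if ts = {#} then {#l#} else \<Sum>\<^sub># (image_mset leaf_labels ts))"

text \<open>
  Simple graphs are symmetric loop-free digraphs without multiple arcs (locale \<open>graph\<close>).
  Equality of multisets in the last conjunct says that each \<open>{v}\<close> labels exactly one leaf
  and that there are no further leaves.
\<close>

definition assembly_tree :: "('a, 'b) pre_digraph \<Rightarrow> 'a set ltree \<Rightarrow> bool" where
  "assembly_tree G t \<longleftrightarrow>
    (\<forall>s\<in>subtrees t. label s \<subseteq> verts G) \<and>
    label t = verts G \<and>
    (\<forall>s\<in>subtrees t. internal s \<longrightarrow>
      2 \<le> size (children s) \<and> label s = (\<Union>c\<in>set_mset (children s). label c)) \<and>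
    leaf_labels t = image_mset (\<lambda>v. {v}) (mset_set (verts G))"

text \<open>The name \<open>connected\<close> alone could also mean topological connectedness.\<close>

definition connected_gluing :: "('a, 'b) pre_digraph \<Rightarrow> 'a set ltree \<Rightarrow> bool" where
  "connected_gluing G t \<longleftrightarrow>
    (\<forall>s\<in>subtrees t. internal s \<longrightarrow> Digraph_Component.connected (induce_subgraph G (label s)))"

definition num_connected_assembly_trees :: "('a, 'b) pre_digraph \<Rightarrow> nat" where
  "num_connected_assembly_trees G = card {t. assembly_tree G t \<and> connected_gluing G t}"

text \<open>
  The cyclic successor of \<open>i\<close> in \<open>1, \<dots>, n\<close> is \<open>i mod n + 1\<close>.  Because of \<open>i \<noteq> j\<close> this is a
  single vertex for \<open>n = 1\<close>, and a single edge for \<open>n = 2\<close>.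
\<close>

definition cycle_graph :: "nat \<Rightarrow> nat pair_pre_digraph" where
  "cycle_graph n = \<lparr> pverts = {1..n},
     parcs = {(i, j). i \<in> {1..n} \<and> j \<in> {1..n} \<and> i \<noteq> j \<and>
                      (j = i mod n + 1 \<or> i = j mod n + 1)} \<rparr>"

lemma graph_cycle_graph: "graph (with_proj (cycle_graph n))"
proof -
  have "finite (parcs (cycle_graph n))"
    by (rule finite_subset[of _ "{1..n} \<times> {1..n}"]) (auto simp: cycle_graph_def)
  then have "pair_graph (cycle_graph n)"
    by unfold_locales
      (auto simp: cycle_graph_def symmetric_def arcs_ends_def arc_to_ends_def intro!: symI)
  then show ?thesis
    by (rule pair_graph.pair_graphD_graph)
qed

text \<open>
  The power series \<open>(1 + x - sqrt (1 - 6 x + x\<^sup>2)) / 4\<close>; the root is the one with constant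
  term 1, so the coefficient at 0 vanishes.
\<close>

definition super_catalan_fps :: "real fps" where
  "super_catalan_fps =
    (1 + fps_X - fps_radical root 2 (1 - 6 * fps_X + fps_X ^ 2)) / 4"

definition super_catalan :: "nat \<Rightarrow> real" where
  "super_catalan n = fps_nth super_catalan_fps n"

definition compositions :: "nat \<Rightarrow> nat \<Rightarrow> nat list set" where
  "compositions n k = {is. length is = k \<and> (\<forall>i\<in>set is. 1 \<le> i) \<and> sum_list is = n}"

end

theory Submission
  imports Defs "HOL-Library.Disjoint_Sets" "HOL-Library.FuncSet"
begin

text \<open>
  The children of the root of an assembly tree partition the vertex set, and the tree is determined
  by this partition and a tree on each block (\<open>gluing_trees_bij_partitions\<close>).  Allowing also the
  partition with one block, one counts forests; since removing the root turns a tree into a forest of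
  at least two trees, a connected set of at least two vertices carries exactly twice as many forests as
  trees (\<open>forest_count_eq_twice_tree_count\<close>).  Forests, in turn, can be enumerated by their tree
  through a fixed vertex \<open>x\<close> (\<open>forest_count_split_block\<close>), and the vertex set of this tree is connected.

  On a path take for \<open>x\<close> an end point.  The tree through \<open>x\<close> covers an initial segment and leaves a
  path.  So if \<open>F\<close> generates the numbers of trees on paths and \<open>W\<close> the numbers of forests, then
  \<open>W = 1 + F W\<close>, while \<open>W = 1 + 2 F - x\<close> by the doubling.  Eliminating \<open>W\<close> gives
  \<open>2 F\<^sup>2 - (1 + x) F + x = 0\<close>, the equation of the super Catalan numbers
  (\<open>path_like_counts\<close>).

  On the cycle take for \<open>x\<close> the vertex 1.  A tree through it that does not span the cycle covers one of
  the \<open>i\<close> arcs of length \<open>i\<close> through 1, for some \<open>i < n\<close>, and leaves a path with \<open>n - i\<close> vertices.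
  Both parts have been counted, and the doubling once more yields
  the sum of \<open>i SC(i) W(n - i)\<close> over \<open>i < n\<close> as the number of trees on the cycle (\<open>tree_count_cycle\<close>).
  Since \<open>W = 1 / (1 - F)\<close>, the number \<open>W(n - i)\<close> is a sum over all compositions of \<open>n - i\<close>; putting
  the part \<open>i\<close> in front of them gives the claim (\<open>sum_compositions_first_part_weighted\<close>).
\<close>

section \<open>Sums over set partitions\<close>

lemma sum_mset_set_blocks:
  assumes "finite \<pi>" "disjoint \<pi>" "\<And>B. B \<in> \<pi> \<Longrightarrow> finite B"
  shows "(\<Sum>B\<in>\<pi>. mset_set B) = mset_set (\<Union>\<pi>)"
  using assms
proof (induction \<pi> rule: finite_induct)
  case (insert B \<pi>)
  then have "B \<inter> \<Union>\<pi> = {}"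
    by (auto simp: pairwise_insert disjnt_def)
  with insert show ?case
    by (simp add: mset_set_Union pairwise_insert)
qed simp

text \<open>
  A partition of \<open>S\<close> amounts to its block \<open>B\<close> through the fixed point \<open>x\<close> and a
  partition of the rest.  Every recursion below comes from this identity: when the weight
  \<open>h\<close> vanishes on disconnected blocks, few choices of \<open>B\<close> survive.
\<close>

lemma sum_partition_on_split_block:
  fixes h :: "'a set \<Rightarrow> 'b::comm_semiring_1"
  assumes "finite S" "x \<in> S"
  shows "(\<Sum>\<pi> | partition_on S \<pi>. \<Prod>B\<in>\<pi>. h B) =
    (\<Sum>B | B \<subseteq> S \<and> x \<in> B. h B * (\<Sum>\<pi> | partition_on (S - B) \<pi>. \<Prod>C\<in>\<pi>. h C))"
proof -
  let ?D = "SIGMA B:{B. B \<subseteq> S \<and> x \<in> B}. {\<pi>. partition_on (S - B) \<pi>}"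
  have new: "B \<notin> \<pi>" if "partition_on (S - B) \<pi>" "x \<in> B" for B \<pi>
    using that by (auto simp: partition_on_def)
  have fin: "finite \<pi>" if "partition_on (S - B) \<pi>" for B \<pi>
    using that assms by (meson finite_Diff finite_elements)
  have "bij_betw (\<lambda>(B, \<pi>). insert B \<pi>) ?D {\<pi>. partition_on S \<pi>}"
  proof (rule bij_betwI')
    fix u v assume u: "u \<in> ?D" and v: "v \<in> ?D"
    obtain B \<pi> C \<rho> where uv: "u = (B, \<pi>)" "v = (C, \<rho>)" by fastforce
    \<comment> \<open>\<open>B\<close> is recovered from the image as its only block that contains \<open>x\<close>.\<close>
    have "x \<notin> \<Union>\<pi>" "x \<notin> \<Union>\<rho>"
      using u v uv by (auto simp: partition_on_def)
    moreover have "B \<notin> \<pi>" "C \<notin> \<rho>" "x \<in> B" "x \<in> C"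
      using u v uv new by auto
    ultimately show "((case u of (B, \<pi>) \<Rightarrow> insert B \<pi>) = (case v of (B, \<pi>) \<Rightarrow> insert B \<pi>)) = (u = v)"
      unfolding uv by (auto simp: insert_eq_iff)
  next
    fix u assume "u \<in> ?D"
    then obtain B \<pi> where u: "u = (B, \<pi>)" "B \<subseteq> S" "x \<in> B" "partition_on (S - B) \<pi>"
      by auto
    then have "disjnt B (\<Union>\<pi>)"
      by (auto simp: partition_on_def disjnt_def)
    with u show "(case u of (B, \<pi>) \<Rightarrow> insert B \<pi>) \<in> {\<pi>. partition_on S \<pi>}"
      by (auto simp: partition_on_insert)
  next
    fix \<rho> assume "\<rho> \<in> {\<pi>. partition_on S \<pi>}"
    then have \<rho>: "partition_on S \<rho>" by simp
    then obtain B where B: "B \<in> \<rho>" "x \<in> B" "B \<subseteq> S"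
      using assms by (auto simp: partition_on_def)
    have "partition_on (S - B) (\<rho> - {B})"
      using \<rho> B by (auto simp: partition_on_def disjoint_def)
    with B show "\<exists>u\<in>?D. \<rho> = (case u of (B, \<pi>) \<Rightarrow> insert B \<pi>)"
      by (intro bexI[of _ "(B, \<rho> - {B})"]) auto
  qed
  from sum.reindex_bij_betw[OF this, of "\<lambda>\<pi>. \<Prod>B\<in>\<pi>. h B", symmetric]
  have "(\<Sum>\<pi> | partition_on S \<pi>. \<Prod>B\<in>\<pi>. h B) = (\<Sum>(B, \<pi>)\<in>?D. \<Prod>C\<in>insert B \<pi>. h C)"
    by (simp add: case_prod_unfold)
  also have "\<dots> = (\<Sum>(B, \<pi>)\<in>?D. h B * (\<Prod>C\<in>\<pi>. h C))"
    using new fin by (intro sum.cong) auto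
  also have "\<dots> = (\<Sum>B | B \<subseteq> S \<and> x \<in> B. \<Sum>\<pi> | partition_on (S - B) \<pi>. h B * (\<Prod>C\<in>\<pi>. h C))"
    using assms by (intro sum.Sigma[symmetric]) (auto intro: finitely_many_partition_on)
  finally show ?thesis
    by (simp add: sum_distrib_left)
qed

section \<open>Gluing trees and set partitions\<close>

text \<open>
  Connectedness enters only as a predicate \<open>P\<close> on vertex sets, so that the counting can be done
  once for all graphs, and trees are considered for every \<open>S\<close>, not only for the full vertex set,
  so that the children of the root are again trees of the same kind.
\<close>

definition gluing_node :: "('a set \<Rightarrow> bool) \<Rightarrow> 'a set ltree \<Rightarrow> bool" where
  "gluing_node P s \<longleftrightarrow> (internal s \<longrightarrow>
     2 \<le> size (children s) \<and> label s = (\<Union>c\<in>set_mset (children s). label c) \<and> P (label s))"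

definition gluing_trees :: "('a set \<Rightarrow> bool) \<Rightarrow> 'a set \<Rightarrow> 'a set ltree set" where
  "gluing_trees P S = {t. label t = S \<and>
     leaf_labels t = image_mset (\<lambda>v. {v}) (mset_set S) \<and> (\<forall>s\<in>subtrees t. gluing_node P s)}"

lemma Node_in_gluing_trees_iff:
  assumes "ts \<noteq> {#}"
  shows "Node S ts \<in> gluing_trees P S \<longleftrightarrow>
    \<Sum>\<^sub># (image_mset leaf_labels ts) = image_mset (\<lambda>v. {v}) (mset_set S) \<and>
    2 \<le> size ts \<and> S = (\<Union>c\<in>set_mset ts. label c) \<and> P S \<and>
    (\<forall>c\<in>#ts. \<forall>s\<in>subtrees c. gluing_node P s)"
  using assms by (auto simp: gluing_trees_def gluing_node_def[of P "Node S ts"])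

lemma leaf_labels_nonempty: "leaf_labels t \<noteq> {#}"
  by (induction t) (auto simp: sum_mset.insert elim!: multiset_cases)

text \<open>
  The union condition at internal nodes makes a label the union of the leaf labels below it.
  This lets the labels of children be read off from leaf multisets, where repetitions are visible.
\<close>

lemma Union_leaf_labels:
  assumes "\<forall>s\<in>subtrees t. internal s \<longrightarrow> label s = (\<Union>c\<in>set_mset (children s). label c)"
  shows "\<Union> (set_mset (leaf_labels t)) = label t"
  using assms
proof (induction t)
  case (Node l ts)
  show ?case
  proof (cases "ts = {#}")
    case False
    then have "\<Union> (set_mset (leaf_labels (Node l ts))) = (\<Union>c\<in>set_mset ts. \<Union> (set_mset (leaf_labels c)))"
      by auto
    also have "\<dots> = (\<Union>c\<in>set_mset ts. label c)"
      using Node by (intro SUP_cong refl) auto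
    finally show ?thesis using Node.prems False by simp
  qed simp
qed

text \<open>
  A multiset without repetitions that is written as a sum of nonempty multisets has summands that
  are pairwise disjoint, hence also pairwise distinct.  With \<open>leaf_labels\<close> for \<open>f\<close> this turns the
  multiset of children of a node into an honest set of trees on disjoint label sets.
\<close>

lemma children_disjoint_of_distinct_sum:
  assumes sum: "\<Sum>\<^sub># (image_mset f ts) = M"
    and M: "\<And>x. count M x \<le> 1"
    and nonempty: "\<And>c. c \<in># ts \<Longrightarrow> f c \<noteq> {#}"
  shows "ts = mset_set (set_mset ts)"
    and "c \<in># ts \<Longrightarrow> count (f c) x \<le> 1"
    and "\<lbrakk>c \<in># ts; d \<in># ts; x \<in># f c; x \<in># f d\<rbrakk> \<Longrightarrow> c = d"
proof -
  have apart: False if "x \<in># f c" "x \<in># f d" "ts = add_mset c (add_mset d R)" for c d x R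
  proof -
    have "1 \<le> count (f c) x" "1 \<le> count (f d) x"
      using that(1,2) by (simp_all add: Suc_le_eq)
    moreover have "count (f c) x + count (f d) x \<le> count M x"
      using sum that(3) by auto
    ultimately have "2 \<le> count M x" by linarith
    with M[of x] show False by simp
  qed
  have once: "count ts c = 1" if c: "c \<in># ts" for c
  proof (rule ccontr)
    assume "count ts c \<noteq> 1"
    with c have "c \<in># ts - {#c#}"
      by (simp add: in_diff_count Suc_lessI)
    then obtain R where "ts - {#c#} = add_mset c R"
      by (meson mset_add)
    with c have "ts = add_mset c (add_mset c R)"
      by (metis insert_DiffM)
    moreover obtain x where "x \<in># f c"
      using nonempty[OF c] by auto
    ultimately show False using apart by blast
  qed
  show "ts = mset_set (set_mset ts)"
    by (rule multiset_eqI) (metis count_mset_set' finite_set_mset not_in_iff once)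
  show "count (f c) x \<le> 1" if c: "c \<in># ts"
  proof -
    obtain R where "ts = add_mset c R" using c by (meson mset_add)
    then show ?thesis using sum M[of x] by auto
  qed
  show "c = d" if cd: "c \<in># ts" "d \<in># ts" "x \<in># f c" "x \<in># f d"
  proof (rule ccontr)
    assume "c \<noteq> d"
    obtain R where R: "ts = add_mset c R" using cd by (meson mset_add)
    with \<open>c \<noteq> d\<close> cd have "d \<in># R" by simp
    then obtain R' where "R = add_mset d R'" by (meson mset_add)
    with R apart cd show False by blast
  qed
qed

lemma finite_gluing_tree_label:
  assumes "t \<in> gluing_trees P S"
  shows "finite S" "S \<noteq> {}"
proof -
  have "image_mset (\<lambda>v. {v}) (mset_set S) \<noteq> {#}"
    using assms leaf_labels_nonempty[of t] by (auto simp: gluing_trees_def)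
  then show "finite S" "S \<noteq> {}"
    by (auto simp: mset_set_empty_iff)
qed

lemma count_singletons_le_1: "count (image_mset (\<lambda>v. {v}) (mset_set S)) x \<le> 1"
  by (simp add: image_mset_mset_set count_mset_set')

text \<open>
  The leaves below a child are singletons without repetitions whose union is the label of the child,
  so each element of this label occurs as a leaf exactly once.
\<close>

lemma gluing_tree_child:
  assumes t: "Node S ts \<in> gluing_trees P S" and c: "c \<in># ts"
  shows "c \<in> gluing_trees P (label c)"
proof -
  have "finite S" using finite_gluing_tree_label[OF t] by simp
  have ne: "ts \<noteq> {#}" using c by auto
  have sum: "\<Sum>\<^sub># (image_mset leaf_labels ts) = image_mset (\<lambda>v. {v}) (mset_set S)"
    using t ne by (simp add: Node_in_gluing_trees_iff)
  note once = children_disjoint_of_distinct_sum(2)[OF sum count_singletons_le_1 leaf_labels_nonempty c]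
  have nodes: "\<forall>s\<in>subtrees c. gluing_node P s"
    using t c by (auto simp: gluing_trees_def)
  have U: "\<Union> (set_mset (leaf_labels c)) = label c"
    using nodes by (intro Union_leaf_labels) (auto simp: gluing_node_def)
  have "set_mset (leaf_labels c) \<subseteq> set_mset (\<Sum>\<^sub># (image_mset leaf_labels ts))"
    using c by auto
  also have "\<dots> = (\<lambda>v. {v}) ` S"
    unfolding sum using \<open>finite S\<close> by simp
  finally have "set_mset (leaf_labels c) = (\<lambda>v. {v}) ` label c"
    unfolding U[symmetric] by (auto simp: image_iff; blast)
  moreover have "leaf_labels c = mset_set (set_mset (leaf_labels c))"
  proof (rule multiset_eqI)
    fix x show "count (leaf_labels c) x = count (mset_set (set_mset (leaf_labels c))) x"
      using once[of x] by (cases "x \<in># leaf_labels c") (simp_all add: count_mset_set' not_in_iff le_antisym Suc_leI)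
  qed
  ultimately have "leaf_labels c = image_mset (\<lambda>v. {v}) (mset_set (label c))"
    by (simp add: image_mset_mset_set)
  with nodes show ?thesis by (simp add: gluing_trees_def)
qed

lemma gluing_tree_children_disjoint:
  assumes t: "Node S ts \<in> gluing_trees P S" and cd: "c \<in># ts" "d \<in># ts" "label c \<inter> label d \<noteq> {}"
  shows "c = d"
proof -
  have ne: "ts \<noteq> {#}" using cd by auto
  have sum: "\<Sum>\<^sub># (image_mset leaf_labels ts) = image_mset (\<lambda>v. {v}) (mset_set S)"
    using t ne by (simp add: Node_in_gluing_trees_iff)
  obtain x where x: "x \<in> label c" "x \<in> label d" using cd by auto
  have "{x} \<in># leaf_labels e" if "e \<in># ts" "x \<in> label e" for e
  proof -
    have e: "e \<in> gluing_trees P (label e)" by (rule gluing_tree_child[OF t that(1)])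
    then have "leaf_labels e = image_mset (\<lambda>v. {v}) (mset_set (label e))"
      by (simp add: gluing_trees_def)
    with finite_gluing_tree_label(1)[OF e] that(2) show ?thesis by simp
  qed
  then show ?thesis
    using children_disjoint_of_distinct_sum(3)[OF sum count_singletons_le_1 leaf_labels_nonempty cd(1,2)] cd x by blast
qed

lemma gluing_tree_children_distinct:
  assumes t: "Node S ts \<in> gluing_trees P S"
  shows "ts = mset_set (set_mset ts)"
proof (cases "ts = {#}")
  case False
  then have sum: "\<Sum>\<^sub># (image_mset leaf_labels ts) = image_mset (\<lambda>v. {v}) (mset_set S)"
    using t by (simp add: gluing_trees_def)
  show ?thesis
    by (rule children_disjoint_of_distinct_sum(1)[OF sum count_singletons_le_1 leaf_labels_nonempty])
qed simp

lemma gluing_trees_singleton: "gluing_trees P {v} = {Node {v} {#}}"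
proof -
  have "ts = {#}" if t: "Node {v} ts \<in> gluing_trees P {v}" for ts
  proof (rule ccontr)
    assume ne: "ts \<noteq> {#}"
    have "\<Sum>\<^sub># (image_mset leaf_labels ts) = {#{v}#}"
      using t ne by (simp add: Node_in_gluing_trees_iff)
    then have "size (\<Sum>\<^sub># (image_mset leaf_labels ts)) = 1" by simp
    moreover have "size (\<Sum>\<^sub># (image_mset leaf_labels ts)) \<ge> (\<Sum>c\<in>#ts. 1)"
      unfolding size_mset_sum_mset_conv image_mset.compositionality comp_def
      by (intro sum_mset_mono) (metis One_nat_def Suc_leI leaf_labels_nonempty nonempty_has_size)
    moreover have "size ts \<ge> 2"
      using t ne by (simp add: Node_in_gluing_trees_iff)
    ultimately show False by simp
  qed
  moreover have "Node {v} {#} \<in> gluing_trees P {v}"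
    by (simp add: gluing_trees_def gluing_node_def)
  moreover have "t = Node {v} (children t)" if "t \<in> gluing_trees P {v}" for t
    using that by (cases t) (simp add: gluing_trees_def)
  ultimately show ?thesis by (intro set_eqI iffI) (metis singleton_iff, simp)
qed

lemma node_of_partition_in_gluing_trees:
  assumes "finite S" "P S" "partition_on S \<pi>" "\<pi> \<noteq> {S}" "S \<noteq> {}"
    and \<phi>: "\<And>B. B \<in> \<pi> \<Longrightarrow> \<phi> B \<in> gluing_trees P B"
  shows "Node S (image_mset \<phi> (mset_set \<pi>)) \<in> gluing_trees P S"
proof -
  have fin: "finite \<pi>" using assms finite_elements by blast
  have finB: "finite B" if "B \<in> \<pi>" for B
    using that assms by (metis Union_upper finite_subset partition_onD1)
  have ne: "\<pi> \<noteq> {}" using assms by (auto simp: partition_on_def)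
  have "card \<pi> \<noteq> 1"
    using assms by (auto simp: card_1_singleton_iff partition_on_def)
  moreover have "card \<pi> \<noteq> 0" using fin ne by simp
  ultimately have two: "2 \<le> card \<pi>" by linarith
  have lab: "label (\<phi> B) = B" "leaf_labels (\<phi> B) = image_mset (\<lambda>v. {v}) (mset_set B)"
    if "B \<in> \<pi>" for B
    using \<phi>[OF that] by (auto simp: gluing_trees_def)
  have "\<Sum>\<^sub># (image_mset leaf_labels (image_mset \<phi> (mset_set \<pi>))) = (\<Sum>B\<in>\<pi>. leaf_labels (\<phi> B))"
    by (simp add: sum_unfold_sum_mset image_mset.compositionality comp_def)
  also have "\<dots> = (\<Sum>B\<in>\<pi>. image_mset (\<lambda>v. {v}) (mset_set B))"
    using lab by simp
  also have "\<dots> = image_mset (\<lambda>v. {v}) (\<Sum>B\<in>\<pi>. mset_set B)"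
    using fin by (induction \<pi> rule: finite_induct) auto
  also have "\<dots> = image_mset (\<lambda>v. {v}) (mset_set S)"
    using assms finB by (subst sum_mset_set_blocks[OF fin]) (auto simp: partition_on_def)
  finally have leaves: "\<Sum>\<^sub># (image_mset leaf_labels (image_mset \<phi> (mset_set \<pi>))) =
    image_mset (\<lambda>v. {v}) (mset_set S)" .
  have un: "S = (\<Union>c\<in>set_mset (image_mset \<phi> (mset_set \<pi>)). label c)"
    using fin lab assms by (simp add: partition_on_def)
  show ?thesis
    using two leaves un \<phi> fin ne \<open>P S\<close>
    by (subst Node_in_gluing_trees_iff) (auto simp: gluing_trees_def mset_set_empty_iff)
qed

text \<open>
  A tree on \<open>S\<close> is determined by the partition of \<open>S\<close> into the labels of the children of the root
  together with a tree on each block.  The partition \<open>{S}\<close> is excluded because the root has at least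
  two children; conversely a partition of a nonempty set other than \<open>{S}\<close> has at least two blocks.
\<close>

lemma gluing_trees_bij_partitions:
  assumes "finite S" "2 \<le> card S" "P S"
  shows "bij_betw (\<lambda>(\<pi>, \<phi>). Node S (image_mset \<phi> (mset_set \<pi>)))
    (SIGMA \<pi>:{\<pi>. partition_on S \<pi> \<and> \<pi> \<noteq> {S}}. Pi\<^sub>E \<pi> (gluing_trees P)) (gluing_trees P S)"
    (is "bij_betw ?f ?D _")
proof (rule bij_betwI')
  have fin: "finite \<pi>" if "partition_on S \<pi>" for \<pi>
    using that assms(1) by (rule finite_elements[rotated])
  have lab: "label (\<phi> B) = B" if "\<phi> \<in> Pi\<^sub>E \<pi> (gluing_trees P)" "B \<in> \<pi>" for B \<pi> \<phi>
    using PiE_mem[OF that] by (simp add: gluing_trees_def)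
  fix u v assume u: "u \<in> ?D" and v: "v \<in> ?D"
  obtain \<pi> \<phi> \<rho> \<psi> where uv: "u = (\<pi>, \<phi>)" "v = (\<rho>, \<psi>)" by fastforce
  have mem: "partition_on S \<pi>" "partition_on S \<rho>"
      "\<phi> \<in> Pi\<^sub>E \<pi> (gluing_trees P)" "\<psi> \<in> Pi\<^sub>E \<rho> (gluing_trees P)"
    using u v uv by auto
  show "(?f u = ?f v) = (u = v)"
  proof
    assume "?f u = ?f v"
    then have "image_mset \<phi> (mset_set \<pi>) = image_mset \<psi> (mset_set \<rho>)"
      by (simp add: uv)
    then have "set_mset (image_mset \<phi> (mset_set \<pi>)) = set_mset (image_mset \<psi> (mset_set \<rho>))"
      by (rule arg_cong)
    then have im: "\<phi> ` \<pi> = \<psi> ` \<rho>"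
      using fin mem by simp
    have "label ` \<phi> ` \<pi> = \<pi>" "label ` \<psi> ` \<rho> = \<rho>"
      using lab mem by (force simp: image_iff)+
    with im have "\<pi> = \<rho>" by metis
    moreover have "\<phi> B = \<psi> B" if "B \<in> \<pi>" for B
    proof -
      obtain C where C: "C \<in> \<rho>" "\<phi> B = \<psi> C" using im \<open>B \<in> \<pi>\<close> by blast
      then have "B = C" using lab[OF mem(3) that] lab[OF mem(4) C(1)] by metis
      with C show ?thesis by simp
    qed
    ultimately have "\<phi> = \<psi>" using mem by (intro PiE_ext) auto
    with \<open>\<pi> = \<rho>\<close> show "u = v" by (simp add: uv)
  qed simp
next
  fix u assume "u \<in> ?D"
  moreover have "S \<noteq> {}" using assms by auto
  ultimately show "?f u \<in> gluing_trees P S"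
    using assms by (auto intro!: node_of_partition_in_gluing_trees)
next
  fix t assume t: "t \<in> gluing_trees P S"
  obtain ts where ts: "t = Node S ts"
    using t by (cases t) (auto simp: gluing_trees_def)
  note t' = t[unfolded ts]
  have ne: "ts \<noteq> {#}"
  proof
    assume "ts = {#}"
    then have "{#S#} = image_mset (\<lambda>v. {v}) (mset_set S)"
      using t ts by (simp add: gluing_trees_def)
    then have "size {#S#} = size (image_mset (\<lambda>v. {v}) (mset_set S))" by (rule arg_cong)
    then have "card S = 1" by simp
    with assms show False by simp
  qed
  have dist: "ts = mset_set (set_mset ts)" by (rule gluing_tree_children_distinct[OF t'])
  have child: "c \<in> gluing_trees P (label c)" if "c \<in># ts" for c
    by (rule gluing_tree_child[OF t' that])
  have disj: "c = d" if "c \<in># ts" "d \<in># ts" "label c \<inter> label d \<noteq> {}" for c d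
    by (rule gluing_tree_children_disjoint[OF t' that])
  have labne: "label c \<noteq> {}" if "c \<in># ts" for c
    using finite_gluing_tree_label(2)[OF child[OF that]] .
  have inj: "inj_on label (set_mset ts)"
    by (rule inj_onI) (metis disj inf.idem labne)
  define \<pi> where "\<pi> = label ` set_mset ts"
  define \<phi> where "\<phi> = restrict (inv_into (set_mset ts) label) \<pi>"
  have \<phi>: "\<phi> (label c) = c" if "c \<in># ts" for c
    using that inj by (simp add: \<phi>_def \<pi>_def)
  have "2 \<le> size ts" and "S = (\<Union>c\<in>set_mset ts. label c)"
    using t' unfolding Node_in_gluing_trees_iff[OF ne] by blast+
  then have "S = \<Union>\<pi>" unfolding \<pi>_def by simp
  have "disjnt B C" if BC: "B \<in> \<pi>" "C \<in> \<pi>" "B \<noteq> C" for B C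
  proof -
    obtain c d where "c \<in># ts" "d \<in># ts" "B = label c" "C = label d"
      using BC by (auto simp: \<pi>_def)
    with disj[of c d] \<open>B \<noteq> C\<close> show ?thesis by (auto simp: disjnt_def)
  qed
  moreover have "{} \<notin> \<pi>"
    using labne unfolding \<pi>_def by (metis imageE)
  ultimately have part: "partition_on S \<pi>"
    using \<open>S = \<Union>\<pi>\<close> by (intro partition_onI) simp_all
  have "size ts = size (mset_set (set_mset ts))"
    using dist by (rule arg_cong)
  then have "card \<pi> = size ts"
    by (simp add: \<pi>_def card_image[OF inj])
  then have "\<pi> \<noteq> {S}" using \<open>2 \<le> size ts\<close> by auto
  moreover have "\<phi> \<in> Pi\<^sub>E \<pi> (gluing_trees P)"
    using \<phi> child by (intro PiE_I) (auto simp: \<pi>_def \<phi>_def)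
  moreover have "image_mset \<phi> (mset_set \<pi>) = ts"
  proof -
    have "mset_set \<pi> = image_mset label (mset_set (set_mset ts))"
      unfolding \<pi>_def by (rule image_mset_mset_set[OF inj, symmetric])
    also have "\<dots> = image_mset label ts"
      using dist by (rule arg_cong[OF sym])
    finally have "image_mset \<phi> (mset_set \<pi>) = image_mset (\<phi> \<circ> label) ts"
      by (simp add: image_mset.compositionality)
    also have "\<dots> = image_mset (\<lambda>c. c) ts"
      by (intro image_mset_cong) (simp add: \<phi>)
    finally show ?thesis by simp
  qed
  ultimately show "\<exists>u\<in>?D. t = ?f u"
    using part ts by (intro bexI[of _ "(\<pi>, \<phi>)"]) auto
qed

section \<open>Counting trees and forests\<close>

lemma gluing_trees_empty:
  assumes "\<not> P S" "card S \<noteq> 1"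
  shows "gluing_trees P S = {}"
proof -
  have False if t: "Node S ts \<in> gluing_trees P S" for ts
  proof (cases "ts = {#}")
    case True
    with t have "{#S#} = image_mset (\<lambda>v. {v}) (mset_set S)"
      by (simp add: gluing_trees_def)
    then have "size {#S#} = size (image_mset (\<lambda>v. {v}) (mset_set S))" by (rule arg_cong)
    with assms show False by simp
  next
    case False
    with t assms show False by (simp add: Node_in_gluing_trees_iff)
  qed
  moreover have "t = Node S (children t)" if "t \<in> gluing_trees P S" for t
    using that by (cases t) (simp add: gluing_trees_def)
  ultimately show ?thesis by (metis equals0I)
qed

lemma proper_block:
  assumes "finite S" "partition_on S \<pi>" "\<pi> \<noteq> {S}" "B \<in> \<pi>"
  shows "card B < card S"
proof -
  have "B \<noteq> S"
  proof
    assume "B = S"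
    have "C = S" if "C \<in> \<pi>" for C
    proof (rule ccontr)
      assume "C \<noteq> S"
      then have "C \<inter> S = {}"
        using assms that \<open>B = S\<close> partition_onD2[OF assms(2)] by (metis disjointD)
      moreover have "C \<subseteq> S" "C \<noteq> {}"
        using assms that by (auto simp: partition_on_def)
      ultimately show False by auto
    qed
    with assms \<open>B = S\<close> show False by blast
  qed
  moreover have "B \<subseteq> S" using assms by (auto simp: partition_on_def)
  ultimately show ?thesis using assms(1) by (meson psubsetI psubset_card_mono)
qed

lemma finite_gluing_trees: "finite (gluing_trees P S)"
proof (induction "card S" arbitrary: S rule: less_induct)
  case less
  consider "infinite S \<or> S = {}" | "card S = 1" | "\<not> P S" "card S \<noteq> 1"
    | "finite S" "2 \<le> card S" "P S"
    by (metis One_nat_def Suc_1 Suc_leI card_gt_0_iff le_neq_implies_less)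
  then show ?case
  proof cases
    case 1
    then have "gluing_trees P S = {}" using finite_gluing_tree_label[of _ P S] by blast
    then show ?thesis by simp
  next
    case 2
    then obtain v where "S = {v}" by (rule card_1_singletonE)
    then show ?thesis by (simp add: gluing_trees_singleton)
  next
    case 3
    then show ?thesis by (simp add: gluing_trees_empty)
  next
    case 4
    have "finite (Pi\<^sub>E \<pi> (gluing_trees P))" if "partition_on S \<pi>" "\<pi> \<noteq> {S}" for \<pi>
      using proper_block[OF 4(1) that] less finite_elements[OF 4(1) that(1)] by (intro finite_PiE) auto
    then have "finite (SIGMA \<pi>:{\<pi>. partition_on S \<pi> \<and> \<pi> \<noteq> {S}}. Pi\<^sub>E \<pi> (gluing_trees P))"
      using finitely_many_partition_on[OF 4(1)] by (intro finite_SigmaI) auto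
    then show ?thesis
      using bij_betw_finite[OF gluing_trees_bij_partitions[where P = P, OF 4]] by simp
  qed
qed

definition tree_count :: "('a set \<Rightarrow> bool) \<Rightarrow> 'a set \<Rightarrow> real" where
  "tree_count P S = real (card (gluing_trees P S))"

text \<open>
  Forests whose trees cover \<open>S\<close> disjointly, the one-tree forests included.
\<close>

definition forest_count :: "('a set \<Rightarrow> bool) \<Rightarrow> 'a set \<Rightarrow> real" where
  "forest_count P S = (\<Sum>\<pi> | partition_on S \<pi>. \<Prod>B\<in>\<pi>. tree_count P B)"

lemma tree_count_singleton [simp]: "tree_count P {v} = 1"
  by (simp add: tree_count_def gluing_trees_singleton)

lemma forest_count_empty [simp]: "forest_count P {} = 1"
  by (simp add: forest_count_def partition_on_empty)

lemma forest_count_split_block: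
  assumes "finite S" "x \<in> S"
  shows "forest_count P S = (\<Sum>B | B \<subseteq> S \<and> x \<in> B. tree_count P B * forest_count P (S - B))"
  unfolding forest_count_def by (rule sum_partition_on_split_block[OF assms])

text \<open>
  Deleting the root of a tree leaves a forest of at least two trees, and this is a bijection.
  So the forests with one tree are as many as those with several.
\<close>

lemma forest_count_eq_twice_tree_count:
  assumes S: "finite S" "2 \<le> card S" "P S"
  shows "forest_count P S = 2 * tree_count P S"
proof -
  let ?A = "{\<pi>. partition_on S \<pi> \<and> \<pi> \<noteq> {S}}"
  have "S \<noteq> {}" using S by auto
  have finA: "finite ?A"
    using finitely_many_partition_on[OF S(1)] by simp
  have "card (gluing_trees P S) = card (SIGMA \<pi>:?A. Pi\<^sub>E \<pi> (gluing_trees P))"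
    using bij_betw_same_card[OF gluing_trees_bij_partitions[where P = P, OF S]] by simp
  also have "\<dots> = (\<Sum>\<pi>\<in>?A. card (Pi\<^sub>E \<pi> (gluing_trees P)))"
    using finA finite_elements[OF S(1)]
    by (intro card_SigmaI) (auto intro!: finite_PiE finite_gluing_trees)
  also have "\<dots> = (\<Sum>\<pi>\<in>?A. \<Prod>B\<in>\<pi>. card (gluing_trees P B))"
    using finite_elements[OF S(1)] by (intro sum.cong card_PiE) auto
  finally have proper: "tree_count P S = (\<Sum>\<pi>\<in>?A. \<Prod>B\<in>\<pi>. tree_count P B)"
    by (simp add: tree_count_def)
  have "{\<pi>. partition_on S \<pi>} = insert {S} ?A"
    using partition_on_space[OF \<open>S \<noteq> {}\<close>] by auto
  then have "forest_count P S = tree_count P S + (\<Sum>\<pi>\<in>?A. \<Prod>B\<in>\<pi>. tree_count P B)"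
    unfolding forest_count_def using finA by simp
  with proper show ?thesis by simp
qed

section \<open>The recursion of the super Catalan numbers\<close>

text \<open>Squaring the isolated root in the closed form gives the quadratic equation.\<close>

lemma super_catalan_fps_quadratic:
  "2 * super_catalan_fps ^ 2 - (1 + fps_X) * super_catalan_fps + fps_X = 0"
proof -
  let ?a = "1 - 6 * fps_X + fps_X ^ 2 :: real fps"
  let ?R = "fps_radical root 2 ?a"
  have a0: "fps_nth ?a 0 = 1" by (simp add: numeral_fps_const)
  then have R: "?R ^ 2 = ?a"
    using power_radical[of ?a root 1] by (simp add: numeral_2_eq_2)
  have "(4::real fps) * (x / 4) = x" for x :: "real fps"
    by (simp add: numeral_fps_const fps_divide_unit fps_const_inverse mult.left_commute)
  then have "4 * super_catalan_fps = 1 + fps_X - ?R"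
    unfolding super_catalan_fps_def by blast
  then have "?R = 1 + fps_X - 4 * super_catalan_fps" by simp
  with R have "(1 + fps_X - 4 * super_catalan_fps) ^ 2 = ?a" by simp
  then have "8 * (2 * super_catalan_fps ^ 2 - (1 + fps_X) * super_catalan_fps + fps_X) = 0"
    by (simp add: power2_eq_square algebra_simps)
  moreover have "(8 :: real fps) \<noteq> 0" by simp
  ultimately show ?thesis by (simp only: mult_eq_0_iff simp_thms)
qed

lemma super_catalan_0 [simp]: "super_catalan 0 = 0"
  by (simp add: super_catalan_def super_catalan_fps_def numeral_fps_const fps_divide_unit fps_const_inverse)

lemma super_catalan_1 [simp]: "super_catalan (Suc 0) = 1"
proof -
  have "fps_nth (2 * super_catalan_fps ^ 2 - (1 + fps_X) * super_catalan_fps + fps_X) 1 = 0"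
    unfolding super_catalan_fps_quadratic by simp
  then show ?thesis
    using super_catalan_0
    by (simp add: super_catalan_def numeral_fps_const power2_eq_square fps_mult_nth_1 algebra_simps)
qed

text \<open>
  This sequence will count the forests on a path with \<open>m\<close> vertices.  The value 1 at 0 belongs to the
  empty forest; at 1 there is no doubling, since a single leaf has no children to form a second forest.
\<close>

definition super_catalan_forests :: "nat \<Rightarrow> real" where
  "super_catalan_forests m = (if m \<le> 1 then 1 else 2 * super_catalan m)"

text \<open>
  With \<open>F\<close> the generating function of the super Catalan numbers, the one of \<open>super_catalan_forests\<close> is
  \<open>W = 1 + 2 F - x\<close>.  The quadratic equation says \<open>(1 - F) W = 1\<close>, and the recursion is
  the comparison of coefficients in \<open>W = 1 + F W\<close>.
\<close>

lemma super_catalan_forests_rec: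
  assumes "1 \<le> m"
  shows "super_catalan_forests m =
    (\<Sum>i=1..m. super_catalan i * super_catalan_forests (m - i))"
proof -
  define W where "W = Abs_fps super_catalan_forests"
  have W: "W = 1 + 2 * super_catalan_fps - fps_X"
  proof (rule fps_ext)
    fix n show "fps_nth W n = fps_nth (1 + 2 * super_catalan_fps - fps_X) n"
      using super_catalan_0 super_catalan_1
      by (cases "n = 0"; cases "n = 1")
        (simp_all add: W_def super_catalan_forests_def super_catalan_def numeral_fps_const)
  qed
  have "W - super_catalan_fps * W =
      1 - (2 * super_catalan_fps ^ 2 - (1 + fps_X) * super_catalan_fps + fps_X)"
    unfolding W by (simp add: power2_eq_square algebra_simps)
  then have "W = 1 + super_catalan_fps * W"
    by (simp add: super_catalan_fps_quadratic diff_eq_eq)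
  then have "fps_nth W m = fps_nth (1 + super_catalan_fps * W) m" by (rule arg_cong)
  also have "\<dots> = (\<Sum>i=0..m. super_catalan i * super_catalan_forests (m - i))"
    using assms by (simp add: fps_mult_nth W_def super_catalan_def)
  also have "\<dots> = (\<Sum>i=1..m. super_catalan i * super_catalan_forests (m - i))"
    by (simp add: sum.atLeast_Suc_atMost)
  finally show ?thesis by (simp add: W_def)
qed

section \<open>Gluing trees on paths\<close>

text \<open>
  All that the counting needs to know about an induced path \<open>q 0, \<dots>, q (m - 1)\<close>: the connected sets
  of its vertices are the nonempty intervals.
\<close>

definition path_like :: "('a set \<Rightarrow> bool) \<Rightarrow> (nat \<Rightarrow> 'a) \<Rightarrow> nat \<Rightarrow> bool" where
  "path_like P q m \<longleftrightarrow> inj_on q {..<m} \<and>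
     (\<forall>I\<subseteq>{..<m}. P (q ` I) \<longleftrightarrow> (\<exists>a b. a < b \<and> I = {a..<b}))"

lemma path_like_inj_on: "path_like P q m \<Longrightarrow> inj_on q {..<m}"
  by (simp add: path_like_def)

lemma path_like_iff:
  "path_like P q m \<Longrightarrow> I \<subseteq> {..<m} \<Longrightarrow> P (q ` I) \<longleftrightarrow> (\<exists>a b. a < b \<and> I = {a..<b})"
  by (simp add: path_like_def)

lemma path_like_prefix:
  assumes "path_like P q m" "k \<le> m"
  shows "path_like P q k"
proof -
  have sub: "{..<k} \<subseteq> {..<m}" using assms by auto
  then have "inj_on q {..<k}"
    using path_like_inj_on[OF assms(1)] by (rule inj_on_subset[rotated])
  then show ?thesis
    unfolding path_like_def using path_like_iff[OF assms(1) subset_trans[OF _ sub]] by simp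
qed

lemma path_like_suffix:
  assumes "path_like P q (k + m)"
  shows "path_like P (\<lambda>i. q (k + i)) m"
proof -
  have "inj_on (\<lambda>i. q (k + i)) {..<m}"
  proof (rule inj_onI)
    fix x y assume "x \<in> {..<m}" "y \<in> {..<m}" "q (k + x) = q (k + y)"
    then show "x = y"
      using inj_onD[OF path_like_inj_on[OF assms], of "k + x" "k + y"] by simp
  qed
  moreover have "P ((\<lambda>i. q (k + i)) ` I) \<longleftrightarrow> (\<exists>a b. a < b \<and> I = {a..<b})" if "I \<subseteq> {..<m}" for I
  proof -
    have "(+) k ` I \<subseteq> {..<k + m}" using that by auto
    with assms have "P (q ` (+) k ` I) \<longleftrightarrow> (\<exists>a b. a < b \<and> (+) k ` I = {a..<b})"
      by (rule path_like_iff)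
    also have "\<dots> \<longleftrightarrow> (\<exists>a b. a < b \<and> I = {a..<b})"
    proof safe
      fix a b :: nat assume ab: "a < b" "(+) k ` I = {a..<b}"
      then have "k \<le> a" by (metis atLeastLessThan_iff imageE le_add1 order_refl)
      have "I = {a - k..<b - k}"
      proof (rule set_eqI)
        fix x
        have "x \<in> I \<longleftrightarrow> k + x \<in> (+) k ` I" by auto
        then show "x \<in> I \<longleftrightarrow> x \<in> {a - k..<b - k}"
          using ab \<open>k \<le> a\<close> by auto
      qed
      moreover have "a - k < b - k" using ab \<open>k \<le> a\<close> by simp
      ultimately show "\<exists>a b. a < b \<and> I = {a..<b}" by blast
    next
      fix a b :: nat assume "a < b"
      then show "\<exists>a' b'. a' < b' \<and> (+) k ` {a..<b} = {a'..<b'}"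
        by (intro exI[of _ "a + k"] exI[of _ "b + k"]) simp
    qed
    finally show ?thesis by (simp add: image_image)
  qed
  ultimately show ?thesis by (simp add: path_like_def)
qed

text \<open>
  The block through the end point \<open>q 0\<close> has to be an initial segment, of some length \<open>i\<close>,
  and the rest is again a path.
\<close>

lemma forest_count_path_split:
  assumes path: "path_like P q m" and "1 \<le> m"
  shows "forest_count P (q ` {..<m}) =
    (\<Sum>i=1..m. tree_count P (q ` {..<i}) * forest_count P ((\<lambda>j. q (i + j)) ` {..<m - i}))"
proof -
  let ?S = "q ` {..<m}"
  let ?g = "\<lambda>B. tree_count P B * forest_count P (?S - B)"
  have inj: "inj_on q {..<m}" by (rule path_like_inj_on[OF path])
  have "forest_count P ?S = (\<Sum>B | B \<subseteq> ?S \<and> q 0 \<in> B. ?g B)"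
    using assms by (intro forest_count_split_block) auto
  also have "\<dots> = sum ?g ((\<lambda>i. q ` {..<i}) ` {1..m})"
  proof (rule sum.mono_neutral_right)
    show "\<forall>B\<in>{B. B \<subseteq> ?S \<and> q 0 \<in> B} - (\<lambda>i. q ` {..<i}) ` {1..m}. ?g B = 0"
    proof
      fix B assume B: "B \<in> {B. B \<subseteq> ?S \<and> q 0 \<in> B} - (\<lambda>i. q ` {..<i}) ` {1..m}"
      then have "B \<subseteq> q ` {..<m}" "q 0 \<in> B" by simp_all
      then obtain I where I: "I \<subseteq> {..<m}" "B = q ` I" by (meson subset_imageE)
      have "0 \<in> I"
        using \<open>q 0 \<in> B\<close> I(2) inj_on_image_mem_iff[OF inj _ I(1), of 0] \<open>1 \<le> m\<close> by simp
      have "\<not> (\<exists>a b. a < b \<and> I = {a..<b})"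
      proof
        assume "\<exists>a b. a < b \<and> I = {a..<b}"
        then obtain b where b: "I = {..<b}" "0 < b"
          using \<open>0 \<in> I\<close> by (metis atLeast0LessThan atLeastLessThan_iff le_zero_eq)
        then have "b \<in> {1..m}" using I by auto
        with B I b show False by blast
      qed
      then have "\<not> P B"
        using path_like_iff[OF path I(1)] I(2) by simp
      moreover have "I \<noteq> {0}"
        using \<open>\<not> (\<exists>a b. a < b \<and> I = {a..<b})\<close> by (metis atLeastLessThan_singleton lessI)
      then have "card I \<noteq> 1" using \<open>0 \<in> I\<close> by (auto simp: card_1_singleton_iff)
      moreover have "card B = card I" using I inj by (metis card_image inj_on_subset)
      ultimately have "gluing_trees P B = {}"
        by (intro gluing_trees_empty) simp_all
      then show "?g B = 0" by (simp add: tree_count_def)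
    qed
  qed (auto simp: Suc_le_eq)
  also have "\<dots> = (\<Sum>i=1..m. ?g (q ` {..<i}))"
  proof (rule sum.reindex_cong[OF _ refl refl])
    show "inj_on (\<lambda>i. q ` {..<i}) {1..m}"
    proof (rule inj_onI)
      fix i j assume "i \<in> {1..m}" "j \<in> {1..m}" "q ` {..<i} = q ` {..<j}"
      then have "{..<i} = {..<j}" using inj by (auto simp: inj_on_image_eq_iff)
      then show "i = j" by simp
    qed
  qed
  also have "\<dots> = (\<Sum>i=1..m. tree_count P (q ` {..<i}) * forest_count P ((\<lambda>j. q (i + j)) ` {..<m - i}))"
  proof (rule sum.cong[OF refl])
    fix i assume i: "i \<in> {1..m}"
    have "?S - q ` {..<i} = q ` ({..<m} - {..<i})"
      using inj i by (intro inj_on_image_set_diff[symmetric]) auto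
    also have "{..<m} - {..<i} = {i..<m}" by auto
    also have "{i..<m} = (+) i ` {..<m - i}"
      using i by (simp add: lessThan_atLeast0)
    finally show "?g (q ` {..<i}) = tree_count P (q ` {..<i}) * forest_count P ((\<lambda>j. q (i + j)) ` {..<m - i})"
      by (simp add: image_image)
  qed
  finally show ?thesis .
qed

text \<open>
  By induction, all terms of the splitting but the last one (\<open>i = m\<close>, a forest with one tree) agree
  with those of the recursion for \<open>super_catalan_forests m\<close>.  This alone relates the two unknown
  numbers, forests and trees on the whole path; that forests are twice as many as trees
  determines both.
\<close>

lemma path_like_counts:
  assumes "path_like P q m"
  shows "forest_count P (q ` {..<m}) = super_catalan_forests m \<and>
    (1 \<le> m \<longrightarrow> tree_count P (q ` {..<m}) = super_catalan m)"
  using assms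
proof (induction m arbitrary: q rule: less_induct)
  case (less m)
  show ?case
  proof (cases "m = 0")
    case True
    then show ?thesis by (simp add: super_catalan_forests_def)
  next
    case False
    let ?S = "q ` {..<m}"
    have term_eq: "tree_count P (q ` {..<i}) * forest_count P ((\<lambda>j. q (i + j)) ` {..<m - i}) =
        super_catalan i * super_catalan_forests (m - i)" if i: "i \<in> {1..<m}" for i
    proof -
      have "path_like P q i" "path_like P (\<lambda>j. q (i + j)) (m - i)"
        using i less.prems path_like_prefix[of P q m i] path_like_suffix[of P q i "m - i"] by auto
      with i less.IH[of i q] less.IH[of "m - i" "\<lambda>j. q (i + j)"] show ?thesis by simp
    qed
    have "forest_count P ?S =
        (\<Sum>i=1..m. tree_count P (q ` {..<i}) * forest_count P ((\<lambda>j. q (i + j)) ` {..<m - i}))"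
      using less.prems False by (intro forest_count_path_split) auto
    also have "\<dots> = tree_count P ?S +
        (\<Sum>i=1..<m. tree_count P (q ` {..<i}) * forest_count P ((\<lambda>j. q (i + j)) ` {..<m - i}))"
      using False by (simp add: sum.last_plus)
    also have "\<dots> = tree_count P ?S + (\<Sum>i=1..<m. super_catalan i * super_catalan_forests (m - i))"
      using term_eq by simp
    also have "(\<Sum>i=1..<m. super_catalan i * super_catalan_forests (m - i)) =
        super_catalan_forests m - super_catalan m"
      using False super_catalan_forests_rec[of m]
      by (simp add: sum.last_plus super_catalan_forests_def[of 0])
    finally have forest: "forest_count P ?S =
        tree_count P ?S + super_catalan_forests m - super_catalan m" by simp
    have tree: "tree_count P ?S = super_catalan m"
    proof (cases "m = 1")
      case True
      then have "?S = {q 0}" by auto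
      with True show ?thesis by simp
    next
      case m: False
      have "inj_on q {..<m}" by (rule path_like_inj_on[OF less.prems])
      moreover have "P ?S"
        using path_like_iff[OF less.prems order_refl] False
        by (metis atLeast0LessThan neq0_conv)
      ultimately have "forest_count P ?S = 2 * tree_count P ?S"
        using False m by (intro forest_count_eq_twice_tree_count) (auto simp: card_image)
      with forest show ?thesis using False m by (simp add: super_catalan_forests_def)
    qed
    with forest show ?thesis by simp
  qed
qed

section \<open>Sums over compositions\<close>

lemma finite_compositions: "finite (compositions n k)"
proof (rule finite_subset)
  show "compositions n k \<subseteq> {xs. set xs \<subseteq> {..n} \<and> length xs = k}"
    by (auto simp: compositions_def intro: member_le_sum_list)
qed (simp add: finite_lists_length_eq)

lemma sum_compositions_Suc:
  "(\<Sum>is\<in>compositions n (Suc k). g is) = (\<Sum>i=1..n. \<Sum>js\<in>compositions (n - i) k. g (i # js))"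
proof -
  let ?D = "SIGMA i:{1..n}. compositions (n - i) k"
  have "compositions n (Suc k) = (\<lambda>(i, js). i # js) ` ?D"
    by (force simp: compositions_def length_Suc_conv image_iff)
  moreover have "inj_on (\<lambda>(i, js). i # js) ?D"
    by (auto simp: inj_on_def)
  ultimately have "(\<Sum>is\<in>compositions n (Suc k). g is) = (\<Sum>(i, js)\<in>?D. g (i # js))"
    by (simp add: sum.reindex case_prod_unfold)
  also have "\<dots> = (\<Sum>i=1..n. \<Sum>js\<in>compositions (n - i) k. g (i # js))"
    by (rule sum.Sigma[symmetric]) (simp_all add: finite_compositions)
  finally show ?thesis .
qed

lemma compositions_0_right: "compositions n 0 = (if n = 0 then {[]} else {})"
  by (auto simp: compositions_def)

lemma compositions_0_Suc: "compositions 0 (Suc k) = {}"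
  by (auto simp: compositions_def length_Suc_conv)

text \<open>
  Splitting off the first part of a composition gives the recursion of \<open>super_catalan_forests\<close>.
  The upper bound \<open>N\<close> for the number of parts is left free because it does not drop in step with the
  remainder \<open>n - i\<close>.
\<close>

lemma sum_compositions_super_catalan:
  assumes "n \<le> N"
  shows "(\<Sum>k\<le>N. \<Sum>is\<in>compositions n k. \<Prod>j<k. super_catalan (is ! j)) =
    super_catalan_forests n"
  using assms
proof (induction N arbitrary: n)
  case 0
  then show ?case by (simp add: compositions_0_right super_catalan_forests_def)
next
  case (Suc N)
  show ?case
  proof (cases "n = 0")
    case True
    then show ?thesis
      by (simp add: sum.atMost_Suc_shift compositions_0_right compositions_0_Suc super_catalan_forests_def
          del: sum.atMost_Suc)
  next
    case False
    let ?c = "\<lambda>n k. \<Sum>is\<in>compositions n k. \<Prod>j<k. super_catalan (is ! j)"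
    have "(\<Sum>k\<le>Suc N. ?c n k) = (\<Sum>k\<le>N. ?c n (Suc k))"
      using False by (simp add: sum.atMost_Suc_shift compositions_0_right del: sum.atMost_Suc)
    also have "\<dots> = (\<Sum>k\<le>N. \<Sum>i=1..n. super_catalan i * ?c (n - i) k)"
      by (simp add: sum_compositions_Suc prod.lessThan_Suc_shift sum_distrib_left del: prod.lessThan_Suc)
    also have "\<dots> = (\<Sum>i=1..n. super_catalan i * (\<Sum>k\<le>N. ?c (n - i) k))"
      by (subst sum.swap) (simp add: sum_distrib_left)
    also have "\<dots> = (\<Sum>i=1..n. super_catalan i * super_catalan_forests (n - i))"
      using Suc by (intro sum.cong) auto
    also have "\<dots> = super_catalan_forests n"
      using False by (intro super_catalan_forests_rec[symmetric]) simp
    finally show ?thesis .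
  qed
qed

text \<open>
  Only the first part \<open>i\<close> carries an extra weight; the remaining parts form an arbitrary
  composition of \<open>n - i\<close>.  At least two parts means that this remainder is not 0.
\<close>

lemma sum_compositions_first_part_weighted:
  assumes "1 \<le> n"
  shows "(\<Sum>k=2..n. \<Sum>is\<in>compositions n k. real (is ! 0) * (\<Prod>j<k. super_catalan (is ! j))) =
    (\<Sum>i=1..<n. real i * super_catalan i * super_catalan_forests (n - i))"
proof -
  obtain N where N: "n = Suc N" using assms by (cases n) auto
  let ?c = "\<lambda>n k. \<Sum>is\<in>compositions n k. \<Prod>j<k. super_catalan (is ! j)"
  have "(\<Sum>k=2..n. \<Sum>is\<in>compositions n k. real (is ! 0) * (\<Prod>j<k. super_catalan (is ! j))) =
      (\<Sum>k=1..N. \<Sum>is\<in>compositions n (Suc k). real (is ! 0) * (\<Prod>j<Suc k. super_catalan (is ! j)))"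
    unfolding N numeral_2_eq_2 One_nat_def by (rule sum.shift_bounds_cl_Suc_ivl)
  also have "\<dots> = (\<Sum>k=1..N. \<Sum>i=1..n. real i * super_catalan i * ?c (n - i) k)"
    by (simp add: sum_compositions_Suc prod.lessThan_Suc_shift sum_distrib_left mult.assoc
        del: prod.lessThan_Suc)
  also have "\<dots> = (\<Sum>i=1..n. real i * super_catalan i * (\<Sum>k=1..N. ?c (n - i) k))"
    by (subst sum.swap) (simp add: sum_distrib_left)
  also have "\<dots> = (\<Sum>i=1..<n. real i * super_catalan i * (\<Sum>k=1..N. ?c (n - i) k)) +
      real n * super_catalan n * (\<Sum>k=1..N. ?c 0 k)"
    using assms by (simp add: sum.last_plus)
  also have "(\<Sum>k=1..N. ?c 0 k) = 0"
    by (intro sum.neutral) (auto simp: Suc_le_eq gr0_conv_Suc compositions_0_Suc)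
  also have "(\<Sum>i=1..<n. real i * super_catalan i * (\<Sum>k=1..N. ?c (n - i) k)) =
      (\<Sum>i=1..<n. real i * super_catalan i * super_catalan_forests (n - i))"
  proof (rule sum.cong[OF refl])
    fix i assume i: "i \<in> {1..<n}"
    have "(\<Sum>k=1..N. ?c (n - i) k) = (\<Sum>k\<le>N. ?c (n - i) k)"
      using i by (intro sum.mono_neutral_left) (auto simp: compositions_0_right not_less_eq_eq)
    also have "\<dots> = super_catalan_forests (n - i)"
      using i N by (intro sum_compositions_super_catalan) auto
    finally show "real i * super_catalan i * (\<Sum>k=1..N. ?c (n - i) k) =
        real i * super_catalan i * super_catalan_forests (n - i)" by simp
  qed
  finally show ?thesis by simp
qed

section \<open>Assembly trees are gluing trees\<close>

lemma label_subtree_subset: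
  assumes "\<forall>s\<in>subtrees t. gluing_node P s" "s \<in> subtrees t"
  shows "label s \<subseteq> label t"
  using assms
proof (induction t)
  case (Node l ts)
  show ?case
  proof (cases "s = Node l ts")
    case False
    then obtain c where c: "c \<in># ts" "s \<in> subtrees c" using Node.prems by auto
    then have "label s \<subseteq> label c" using Node by auto
    moreover have "label c \<subseteq> l"
      using Node.prems(1) c by (auto simp: gluing_node_def)
    ultimately show ?thesis by auto
  qed simp
qed

lemma num_connected_assembly_trees_eq:
  "real (num_connected_assembly_trees G) =
    tree_count (\<lambda>S. Digraph_Component.connected (induce_subgraph G S)) (verts G)"
proof -
  let ?P = "\<lambda>S. Digraph_Component.connected (induce_subgraph G S)"
  have "assembly_tree G t \<and> connected_gluing G t \<longleftrightarrow> t \<in> gluing_trees ?P (verts G)" for t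
    using label_subtree_subset[of t ?P]
    unfolding assembly_tree_def connected_gluing_def gluing_trees_def gluing_node_def by blast
  then show ?thesis
    by (simp add: num_connected_assembly_trees_def tree_count_def)
qed

section \<open>Connected vertex sets of a cycle\<close>

text \<open>
  The vertices are unrolled to a periodic sequence indexed by all natural numbers, so that an arc that
  passes from \<open>n\<close> to \<open>1\<close> is the image of an ordinary interval.
\<close>

definition cycle_vertex :: "nat \<Rightarrow> nat \<Rightarrow> nat" where
  "cycle_vertex n i = i mod n + 1"

lemma cycle_vertex_image_shift:
  "(\<lambda>x. cycle_vertex n (k + x)) ` {a..<b} = cycle_vertex n ` {k + a..<k + b}"
proof -
  have "cycle_vertex n ` {k + a..<k + b} = cycle_vertex n ` (+) k ` {a..<b}"
    by (simp add: add.commute)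
  then show ?thesis by (simp only: image_image)
qed

lemma inj_on_cycle_vertex: "inj_on (cycle_vertex n) {a..<a + n}"
proof (rule linorder_inj_onI')
  fix i j assume ij: "i \<in> {a..<a + n}" "j \<in> {a..<a + n}" "i < j"
  show "cycle_vertex n i \<noteq> cycle_vertex n j"
  proof
    assume "cycle_vertex n i = cycle_vertex n j"
    then have "n dvd j - i"
      using ij mod_eq_dvd_iff_nat[of i j n] by (simp add: cycle_vertex_def)
    moreover have "0 < j - i" "j - i < n" using ij by auto
    ultimately show False using nat_dvd_not_less by blast
  qed
qed

lemma cycle_vertex_eq_iff:
  "\<lbrakk>i \<in> {a..<a + n}; j \<in> {a..<a + n}\<rbrakk> \<Longrightarrow> cycle_vertex n i = cycle_vertex n j \<longleftrightarrow> i = j"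
  using inj_on_eq_iff[OF inj_on_cycle_vertex] .

lemma cycle_vertex_window:
  assumes "1 \<le> n"
  shows "cycle_vertex n ` {a..<a + n} = {1..n}"
proof (rule card_subset_eq)
  show "cycle_vertex n ` {a..<a + n} \<subseteq> {1..n}"
    using assms by (auto simp: cycle_vertex_def Suc_le_eq)
  show "card (cycle_vertex n ` {a..<a + n}) = card {1..n}"
    by (simp add: card_image[OF inj_on_cycle_vertex])
qed simp

abbreviation cycle_connected :: "nat \<Rightarrow> nat set \<Rightarrow> bool" where
  "cycle_connected n S \<equiv>
     Digraph_Component.connected (induce_subgraph (with_proj (cycle_graph n)) S)"

definition cycle_adjacency :: "nat \<Rightarrow> nat set \<Rightarrow> nat rel" where
  "cycle_adjacency n S = {(u, v). u \<in> S \<and> v \<in> S \<and> (u, v) \<in> parcs (cycle_graph n)}"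

lemma cycle_connected_iff:
  "cycle_connected n S \<longleftrightarrow>
    S \<noteq> {} \<and> (\<forall>u\<in>S. \<forall>v\<in>S. (u, v) \<in> rtrancl_on S (cycle_adjacency n S))"
proof -
  have "(arcs_ends (induce_subgraph (with_proj (cycle_graph n)) S))\<^sup>s = cycle_adjacency n S"
    by (auto simp: symcl_def arcs_ends_def arc_to_ends_def induce_subgraph_def cycle_graph_def
        cycle_adjacency_def with_proj_def)
  then show ?thesis by (simp add: connected_conv)
qed

lemma cycle_adjacency_vertex_iff:
  assumes "1 \<le> n"
  shows "(cycle_vertex n i, cycle_vertex n j) \<in> parcs (cycle_graph n) \<longleftrightarrow>
    cycle_vertex n i \<noteq> cycle_vertex n j \<and>
    (cycle_vertex n j = cycle_vertex n (Suc i) \<or> cycle_vertex n i = cycle_vertex n (Suc j))"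
proof -
  have "i mod n < n" "j mod n < n" using assms by simp_all
  then show ?thesis
    by (auto simp: cycle_graph_def cycle_vertex_def mod_Suc_eq Suc_le_eq)
qed

lemma cycle_adjacent_Suc:
  assumes "2 \<le> n"
  shows "(cycle_vertex n i, cycle_vertex n (Suc i)) \<in> parcs (cycle_graph n)"
    and "(cycle_vertex n (Suc i), cycle_vertex n i) \<in> parcs (cycle_graph n)"
proof -
  have "cycle_vertex n i \<noteq> cycle_vertex n (Suc i)"
    using assms cycle_vertex_eq_iff[of i i n "Suc i"] by simp
  then show "(cycle_vertex n i, cycle_vertex n (Suc i)) \<in> parcs (cycle_graph n)"
    "(cycle_vertex n (Suc i), cycle_vertex n i) \<in> parcs (cycle_graph n)"
    using assms by (simp_all add: cycle_adjacency_vertex_iff)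
qed

lemma cycle_connected_arc:
  assumes "2 \<le> n" "a < b"
  shows "cycle_connected n (cycle_vertex n ` {a..<b})"
proof -
  let ?S = "cycle_vertex n ` {a..<b}" and ?p = "cycle_vertex n"
  let ?R = "rtrancl_on ?S (cycle_adjacency n ?S)"
  have reach: "(?p a, ?p (a + d)) \<in> ?R \<and> (?p (a + d), ?p a) \<in> ?R" if "a + d < b" for d
    using that
  proof (induction d)
    case 0
    then show ?case by simp
  next
    case (Suc d)
    have mem: "?p (a + d) \<in> ?S" "?p (a + Suc d) \<in> ?S" using Suc.prems by auto
    then have "(?p (a + d), ?p (a + Suc d)) \<in> cycle_adjacency n ?S"
      "(?p (a + Suc d), ?p (a + d)) \<in> cycle_adjacency n ?S"
      using cycle_adjacent_Suc[OF assms(1), of "a + d"] by (simp_all add: cycle_adjacency_def)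
    with Suc mem show ?case
      by (auto intro: rtrancl_on_into_rtrancl_on converse_rtrancl_on_into_rtrancl_on)
  qed
  have "(?p x, ?p y) \<in> ?R" if "x \<in> {a..<b}" "y \<in> {a..<b}" for x y
    using reach[of "x - a"] reach[of "y - a"] that by (auto intro: rtrancl_on_trans)
  then show ?thesis using assms by (auto simp: cycle_connected_iff)
qed

text \<open>
  Fewer than \<open>n\<close> consecutive vertices induce a path.  If \<open>y\<close> is a gap in a set of positions, then
  no edge leads from the positions below \<open>y\<close> to those above it: this is where \<open>m < n\<close> is needed,
  since it prevents the last vertex from being adjacent to the first.
\<close>

lemma path_like_cycle:
  assumes "2 \<le> n" "m < n"
  shows "path_like (cycle_connected n) (\<lambda>i. cycle_vertex n (k + i)) m"
proof -
  let ?q = "\<lambda>i. cycle_vertex n (k + i)"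
  have eq_iff: "?q x = ?q y \<longleftrightarrow> x = y" if "x < n" "y < n" for x y
    using that cycle_vertex_eq_iff[of "k + x" k n "k + y"] by simp
  have "cycle_connected n (?q ` I) \<longleftrightarrow> (\<exists>a b. a < b \<and> I = {a..<b})" if I: "I \<subseteq> {..<m}" for I
  proof
    assume "\<exists>a b. a < b \<and> I = {a..<b}"
    then obtain a b where ab: "a < b" "I = {a..<b}" by blast
    then show "cycle_connected n (?q ` I)"
      using cycle_connected_arc[of n "k + a" "k + b"] assms by (simp add: cycle_vertex_image_shift)
  next
    assume conn: "cycle_connected n (?q ` I)"
    have fin: "finite I" and ne: "I \<noteq> {}"
      using I conn by (auto simp: finite_subset cycle_connected_iff)
    have "y \<in> I" if y: "Min I \<le> y" "y \<le> Max I" for y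
    proof (rule ccontr)
      assume "y \<notin> I"
      have minmax: "Min I \<in> I" "Max I \<in> I" using fin ne by simp_all
      with \<open>y \<notin> I\<close> y have lt: "Min I < y" "y < Max I" by (metis le_neq_implies_less)+
      have "(?q (Min I), ?q (Max I)) \<in> rtrancl_on (?q ` I) (cycle_adjacency n (?q ` I))"
        using conn minmax by (simp add: cycle_connected_iff)
      \<comment> \<open>The positions below the gap are closed under adjacency inside \<open>I\<close>.\<close>
      then have "?q (Max I) \<in> ?q ` {x \<in> I. x < y}"
      proof (induction rule: rtrancl_on_induct)
        case base
        then show ?case using minmax lt by simp
      next
        case (step u v)
        obtain x z where xz: "x \<in> I" "x < y" "u = ?q x" "z \<in> I" "v = ?q z"
          using step by blast
        then have "x < m" "z < m" using I by auto
        have "(?q x, ?q z) \<in> parcs (cycle_graph n)"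
          using step(2) xz by (simp add: cycle_adjacency_def)
        then have "?q z = ?q (Suc x) \<or> ?q x = ?q (Suc z)"
          using assms by (simp add: cycle_adjacency_vertex_iff)
        then have "z = Suc x \<or> x = Suc z"
          using eq_iff[of z "Suc x"] eq_iff[of x "Suc z"] \<open>x < m\<close> \<open>z < m\<close> assms by simp
        moreover have "z \<noteq> y" using xz \<open>y \<notin> I\<close> by auto
        ultimately have "z < y" using xz by linarith
        with xz show ?case by blast
      qed
      then obtain x where "x < y" "x \<in> I" "?q (Max I) = ?q x" by auto
      moreover have "Max I < n" "x < n" using minmax \<open>x \<in> I\<close> I assms by force+
      ultimately show False using eq_iff lt by simp
    qed
    then have "I = {Min I..<Suc (Max I)}"
      using fin by (auto simp: less_Suc_eq_le)
    moreover have "Min I < Suc (Max I)"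
      using fin ne by (simp add: less_Suc_eq_le)
    ultimately show "\<exists>a b. a < b \<and> I = {a..<b}" by blast
  qed
  moreover have "inj_on ?q {..<m}"
    using eq_iff assms by (auto simp: inj_on_def)
  ultimately show ?thesis by (simp add: path_like_def)
qed

section \<open>Gluing trees on cycles\<close>

text \<open>
  The argument \<open>(i, j)\<close> stands for the arc of length \<open>i\<close> that contains the vertex 1 at position \<open>j\<close>,
  counted from 0.  The vertex 1 is \<open>cycle_vertex n n\<close> here, so that the left end point \<open>n - j\<close> does not
  fall below 0.  For given \<open>i < n\<close> there are \<open>i\<close> such arcs; this is the factor \<open>i\<^sub>1\<close> of the
  theorem.
\<close>

definition arc_through_1 :: "nat \<Rightarrow> nat \<times> nat \<Rightarrow> nat set" where
  "arc_through_1 n = (\<lambda>(i, j). cycle_vertex n ` {n - j..<n - j + i})"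

lemma arc_through_1_complement:
  assumes "1 \<le> i" "i < n" "j < i"
  shows "{1..n} - arc_through_1 n (i, j) = cycle_vertex n ` {i - j..<n - j}"
proof -
  let ?W = "{i - j..<i - j + n}"
  have "{1..n} - arc_through_1 n (i, j) = cycle_vertex n ` ?W - cycle_vertex n ` {n - j..<n - j + i}"
    using assms cycle_vertex_window[of n "i - j"] by (simp add: arc_through_1_def)
  also have "\<dots> = cycle_vertex n ` (?W - {n - j..<n - j + i})"
    using assms by (intro inj_on_image_set_diff[OF inj_on_cycle_vertex, symmetric]) auto
  also have "?W - {n - j..<n - j + i} = {i - j..<n - j}"
    using assms by auto
  finally show ?thesis .
qed

text \<open>
  Complements are compared instead of the arcs themselves: the complement of an arc through 1
  lies in the window \<open>{0..<n}\<close>, on which the numbering of the vertices is injective.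
\<close>

lemma inj_on_arc_through_1: "inj_on (arc_through_1 n) (SIGMA i:{1..<n}. {..<i})"
proof (rule inj_onI)
  fix u v assume uv: "u \<in> (SIGMA i:{1..<n}. {..<i})" "v \<in> (SIGMA i:{1..<n}. {..<i})"
    "arc_through_1 n u = arc_through_1 n v"
  obtain i j k l where ijkl: "u = (i, j)" "v = (k, l)" by fastforce
  have ij: "1 \<le> i" "i < n" "j < i" and kl: "1 \<le> k" "k < n" "l < k"
    using uv ijkl by auto
  have "cycle_vertex n ` {i - j..<n - j} = cycle_vertex n ` {k - l..<n - l}"
    using uv(3) arc_through_1_complement[OF ij] arc_through_1_complement[OF kl] by (simp add: ijkl)
  moreover have "{i - j..<n - j} \<subseteq> {0..<0 + n}" "{k - l..<n - l} \<subseteq> {0..<0 + n}" by auto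
  ultimately have "{i - j..<n - j} = {k - l..<n - l}"
    using inj_on_image_eq_iff[OF inj_on_cycle_vertex] by blast
  then have "i - j = k - l \<and> n - j = n - l"
    using ij kl by (subst (asm) atLeastLessThan_eq_iff) auto
  with ij kl show "u = v" by (auto simp: ijkl)
qed

lemma arc_through_1_counts:
  assumes "1 \<le> i" "i < n" "j < i"
  shows "tree_count (cycle_connected n) (arc_through_1 n (i, j)) = super_catalan i"
    and "forest_count (cycle_connected n) ({1..n} - arc_through_1 n (i, j)) =
      super_catalan_forests (n - i)"
proof -
  have window: "cycle_vertex n ` {k..<k + m} = (\<lambda>x. cycle_vertex n (k + x)) ` {..<m}" for k m
    by (simp add: lessThan_atLeast0 cycle_vertex_image_shift)
  show "tree_count (cycle_connected n) (arc_through_1 n (i, j)) = super_catalan i"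
    using path_like_counts[OF path_like_cycle[of n i "n - j"]] assms
    by (simp add: arc_through_1_def window)
  have "n - j = i - j + (n - i)" using assms by simp
  then have "{1..n} - arc_through_1 n (i, j) = (\<lambda>x. cycle_vertex n (i - j + x)) ` {..<n - i}"
    using arc_through_1_complement[OF assms] window by metis
  then show "forest_count (cycle_connected n) ({1..n} - arc_through_1 n (i, j)) =
      super_catalan_forests (n - i)"
    using path_like_counts[OF path_like_cycle[of n "n - i" "i - j"]] assms by simp
qed

text \<open>
  A missing vertex \<open>v\<close> cuts the cycle open to a path, on which connected sets are intervals.
\<close>

lemma proper_connected_is_arc:
  assumes n: "2 \<le> n" and B: "B \<subset> {1..n}" "1 \<in> B" and conn: "cycle_connected n B"
  shows "B \<in> arc_through_1 n ` (SIGMA i:{1..<n}. {..<i})"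
proof -
  obtain v where v: "v \<in> {1..n}" "v \<notin> B" using B by blast
  let ?q = "\<lambda>i. cycle_vertex n (v + i)"
  note shift = cycle_vertex_image_shift[of n v]
  have "cycle_vertex n (v - 1) = v"
  proof -
    have "v - 1 < n" "0 < v" using v by auto
    then show ?thesis by (simp add: cycle_vertex_def)
  qed
  have "{1..n} = cycle_vertex n ` {v - 1..<v - 1 + n}"
    using n by (simp add: cycle_vertex_window)
  also have "{v - 1..<v - 1 + n} = insert (v - 1) {v + 0..<v + (n - 1)}"
    using n v by auto
  also have "cycle_vertex n ` \<dots> = insert v (?q ` {0..<n - 1})"
    unfolding shift using \<open>cycle_vertex n (v - 1) = v\<close> by simp
  finally have "B \<subseteq> ?q ` {..<n - 1}"
    using B v by (auto simp: lessThan_atLeast0)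
  then obtain I where I: "I \<subseteq> {..<n - 1}" "B = ?q ` I" by (meson subset_imageE)
  then obtain a b where ab: "a < b" "I = {a..<b}"
    using conn path_like_iff[OF path_like_cycle[of n "n - 1" v] I(1)] n by auto
  then have "b \<le> n - 1" using I(1) by force
  \<comment> \<open>The position of the vertex 1 is a multiple of \<open>n\<close> strictly between 0 and \<open>2 n\<close>.\<close>
  obtain i where i: "i \<in> I" "1 = ?q i" using B I by blast
  then have "n dvd v + i" by (simp add: cycle_vertex_def dvd_eq_mod_eq_0)
  then obtain c where c: "v + i = n * c" by blast
  have "0 < v + i" "v + i < n * 2" using v i I by auto
  with c have "0 < c" "c < 2" by auto
  with c have "v + i = n" by (cases c) auto
  with i ab have "v + a \<le> n" "n < v + b" by auto
  define j where "j = n - (v + a)"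
  have "B = arc_through_1 n (b - a, j)"
    using I ab \<open>v + a \<le> n\<close> shift by (simp add: arc_through_1_def j_def)
  moreover have "(b - a, j) \<in> (SIGMA i:{1..<n}. {..<i})"
    using ab \<open>b \<le> n - 1\<close> \<open>v + a \<le> n\<close> \<open>n < v + b\<close> n by (auto simp: j_def)
  ultimately show ?thesis by blast
qed

text \<open>
  Splitting the forests on the cycle by the tree through vertex 1: either it spans the whole
  cycle, which gives back the number of trees, or it lives on one of the \<open>i\<close> arcs of length \<open>i < n\<close>
  through 1 and the remaining \<open>n - i\<close> vertices form a path.  As forests are twice as many as trees,
  the second kind alone has the size sought.
\<close>

lemma tree_count_cycle:
  assumes n: "2 \<le> n"
  shows "tree_count (cycle_connected n) {1..n} =
    (\<Sum>i=1..<n. real i * super_catalan i * super_catalan_forests (n - i))"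
proof -
  let ?P = "cycle_connected n" and ?V = "{1..n}" and ?D = "SIGMA i:{1..<n}. {..<i}"
  let ?g = "\<lambda>B. tree_count ?P B * forest_count ?P (?V - B)"
  have proper: "arc_through_1 n u \<subset> ?V \<and> 1 \<in> arc_through_1 n u" if "u \<in> ?D" for u
  proof -
    obtain i j where u: "u = (i, j)" "1 \<le> i" "i < n" "j < i" using \<open>u \<in> ?D\<close> by auto
    have "arc_through_1 n u \<subseteq> ?V"
      using n by (auto simp: arc_through_1_def cycle_vertex_def Suc_le_eq u)
    moreover have "?V - arc_through_1 n u \<noteq> {}"
      unfolding u(1) arc_through_1_complement[OF u(2-4)] using u by auto
    moreover have "1 \<in> arc_through_1 n u"
      using u by (auto simp: arc_through_1_def cycle_vertex_def intro!: image_eqI[of _ _ n])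
    ultimately show ?thesis by blast
  qed
  have "?P ?V"
    using cycle_connected_arc[of n 0 n] cycle_vertex_window[of n 0] n by simp
  then have "2 * tree_count ?P ?V = forest_count ?P ?V"
    using n by (intro forest_count_eq_twice_tree_count[symmetric]) auto
  also have "\<dots> = (\<Sum>B | B \<subseteq> ?V \<and> 1 \<in> B. ?g B)"
    using n by (intro forest_count_split_block) auto
  also have "\<dots> = sum ?g (insert ?V (arc_through_1 n ` ?D))"
  proof (rule sum.mono_neutral_right)
    show "\<forall>B\<in>{B. B \<subseteq> ?V \<and> 1 \<in> B} - insert ?V (arc_through_1 n ` ?D). ?g B = 0"
    proof
      fix B assume "B \<in> {B. B \<subseteq> ?V \<and> 1 \<in> B} - insert ?V (arc_through_1 n ` ?D)"
      then have B: "B \<subset> ?V" "1 \<in> B" "B \<notin> arc_through_1 n ` ?D" by auto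
      have "\<not> ?P B" using proper_connected_is_arc[OF n] B by blast
      moreover have "card B \<noteq> 1"
      proof
        assume "card B = 1"
        then have "B = {1}" using B by (auto simp: card_1_singleton_iff)
        also have "\<dots> = cycle_vertex n ` {0..<1}" by (simp add: cycle_vertex_def)
        finally show False using \<open>\<not> ?P B\<close> cycle_connected_arc[OF n, of 0 1] by simp
      qed
      ultimately show "?g B = 0" by (simp add: tree_count_def gluing_trees_empty)
    qed
    show "insert ?V (arc_through_1 n ` ?D) \<subseteq> {B. B \<subseteq> ?V \<and> 1 \<in> B}"
      using proper n by auto
  qed simp
  also have "\<dots> = ?g ?V + sum ?g (arc_through_1 n ` ?D)"
    using proper by (intro sum.insert) auto
  also have "?g ?V = tree_count ?P ?V" by simp
  also have "sum ?g (arc_through_1 n ` ?D) = (\<Sum>u\<in>?D. ?g (arc_through_1 n u))"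
    by (rule sum.reindex_cong[OF inj_on_arc_through_1 refl refl])
  also have "\<dots> = (\<Sum>(i, j)\<in>?D. super_catalan i * super_catalan_forests (n - i))"
    by (intro sum.cong) (auto simp: arc_through_1_counts simp del: One_nat_def)
  also have "\<dots> = (\<Sum>i=1..<n. \<Sum>j<i. super_catalan i * super_catalan_forests (n - i))"
    by (rule sum.Sigma[symmetric]) auto
  finally show ?thesis by (simp add: mult.assoc)
qed

text \<open>
  The children of the root are labelled by arcs.  In the composition
  \<open>(i\<^sub>1, \<dots>, i\<^sub>k)\<close> the first part is the length of the arc through vertex 1 and the
  others are the lengths of the remaining arcs in cyclic order.
\<close>

theorem theorem3p5:
  fixes n :: nat
  assumes "2 \<le> n"
  shows "real (num_connected_assembly_trees (with_proj (cycle_graph n))) =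
    (\<Sum>k=2..n. \<Sum>is\<in>compositions n k.
      real (is ! 0) * (\<Prod>j<k. super_catalan (is ! j)))"
proof -
  have "verts (with_proj (cycle_graph n)) = {1..n}"
    by (simp add: cycle_graph_def with_proj_def)
  then show ?thesis
    using assms tree_count_cycle[of n] sum_compositions_first_part_weighted[of n]
    by (simp add: num_connected_assembly_trees_eq)
qed

end
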